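(* Let $m\in\mathbb{N}^*$, let $i>1$ be an integer, and let $(G_t)_{t\ge1}$ be the pure anti-preferential attachment random graph process with parameter $m$. Let $\gamma(t)$ be a positive function such that, as $t\to\infty$, $$\gamma(t)\to\infty\qquad\text{and}\qquad \frac{1}{\gamma(t)}\sum_{j=2}^{t}\frac{1}{j\ln j}\to0 .$$ Let $\kappa>1$ be a constant. Then $d(v_i,t)\le\kappa\,\gamma(t)\ln t$ with high probability as $t\to\infty$, that is, $$\lim_{t\to\infty}\mathbb{P}\left(d(v_i,t)\le\kappa\,\gamma(t)\ln t\right)=1 .$$
   Context: $\mathbb{N}^*=\{1,2,\dots\}$. The pure anti-preferential attachment random graph process with parameter $m\in\mathbb{N}^*$ (the case $p=1$ of the paper's PA-APA model) is the following sequence $(G_t)_{t\ge1}$ of random undirected multigraphs, where $G_t$ has vertices $v_1,\dots,v_t$ and $mt$ edges. Let $d(v_i,t)$ denote the degree of $v_i$ in $G_t$ for $t\ge i$ (multiple edges are counted with multiplicity, and a self-loop contributes $2$), and $d(v_i,t)=0$ for $t<i$. Let $\mathcal{F}_t=\sigma(G_s: 1\le s\le t)$. $G_1$ consists of the single vertex $v_1$ with $m$ self-loops (so $d(v_1,1)=2m$). For each $t\ge1$, $G_{t+1}$ is obtained from $G_t$ by adding a new vertex $v_{t+1}$ and $m$ edges joining $v_{t+1}$ to vertices $W_{t+1}^1,\dots,W_{t+1}^m\in\{v_1,\dots,v_t\}$ (repetitions allowed, giving multiple edges), which, given $\mathcal{F}_t$, are chosen independently with $$\mathbb{P}(W_{t+1}^r=v_i\mid\mathcal{F}_t)=\frac{2mt+1-d(v_i,t)}{t(2mt+1-2m)},\qquad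 1\le i\le t,\ 1\le r\le m.$$ *)

theory Defs
  imports "HOL-Probability.Probability" "HOL-Library.Uprod"
begin

text \<open>
  Finite undirected multigraphs: an edge is an unordered pair of (possibly equal) endpoints,
  and parallel edges are recorded by multiplicity. The vertex \<open>v\<^sub>i\<close> is the number \<open>i\<close>.
\<close>

datatype 'v multigraph = Multigraph (verts: "'v set") (edges: "'v uprod multiset")

text \<open>The second summand makes a self-loop contribute 2.\<close>

definition degree :: "'v multigraph \<Rightarrow> 'v \<Rightarrow> nat" where
  "degree H v = size {#e \<in># edges H. v \<in> set_uprod e#} + count (edges H) (Upair v v)"

definition deg :: "(nat \<Rightarrow> 'a \<Rightarrow> nat multigraph) \<Rightarrow> nat \<Rightarrow> nat \<Rightarrow> 'a \<Rightarrow> nat" where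
  "deg G i t \<omega> = (if t < i then 0 else degree (G t \<omega>) i)"

text \<open>\<open>\<F>\<^sub>t = \<sigma>(G\<^sub>s : 1 \<le> s \<le> t)\<close>, multigraphs carrying the discrete \<open>\<sigma>\<close>-algebra.\<close>

definition history :: "'a measure \<Rightarrow> (nat \<Rightarrow> 'a \<Rightarrow> 'g) \<Rightarrow> nat \<Rightarrow> 'a measure" where
  "history M G t = sigma (space M) {G s -` A \<inter> space M | s A. 1 \<le> s \<and> s \<le> t}"

text \<open>A version of the conditional probability of the event \<open>P\<close> given the sub-\<open>\<sigma>\<close>-algebra \<open>F\<close>.\<close>

definition cprob :: "'a measure \<Rightarrow> 'a measure \<Rightarrow> ('a \<Rightarrow> bool) \<Rightarrow> 'a \<Rightarrow> real" where
  "cprob M F P = real_cond_exp M F (indicator {\<omega> \<in> space M. P \<omega>})"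

text \<open>
  \<open>W t r\<close> is the endpoint, other than \<open>v\<^sub>t\<close>, of the \<open>r\<close>-th edge added together with \<open>v\<^sub>t\<close>.
  The values \<open>G 0\<close>, \<open>W 0\<close>, \<open>W 1\<close>, and \<open>W t r\<close> for \<open>r \<notin> {1..m}\<close>, are irrelevant.
\<close>

locale pure_apa_process = prob_space M
  for M :: "'a measure" +
  fixes m :: nat
    and G :: "nat \<Rightarrow> 'a \<Rightarrow> nat multigraph"
    and W :: "nat \<Rightarrow> nat \<Rightarrow> 'a \<Rightarrow> nat"
  assumes m_pos: "1 \<le> m"
    and measurable_G: "\<And>t. 1 \<le> t \<Longrightarrow> G t \<in> measurable M (count_space UNIV)"
    and measurable_W:
      "\<And>t r. 1 \<le> t \<Longrightarrow> r \<in> {1..m} \<Longrightarrow> W (t + 1) r \<in> measurable M (count_space UNIV)"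
    and W_range:
      "\<And>t r \<omega>. 1 \<le> t \<Longrightarrow> r \<in> {1..m} \<Longrightarrow> \<omega> \<in> space M \<Longrightarrow> W (t + 1) r \<omega> \<in> {1..t}"
    and G_initial:
      "\<And>\<omega>. \<omega> \<in> space M \<Longrightarrow> G 1 \<omega> = Multigraph {1} (replicate_mset m (Upair 1 1))"
    and G_step:
      "\<And>t \<omega>. 1 \<le> t \<Longrightarrow> \<omega> \<in> space M \<Longrightarrow>
        G (t + 1) \<omega> = Multigraph (insert (t + 1) (verts (G t \<omega>)))
          (edges (G t \<omega>) + {#Upair (t + 1) (W (t + 1) r \<omega>). r \<in># mset_set {1..m}#})"
    and W_law:
      "\<And>t r i. 1 \<le> t \<Longrightarrow> r \<in> {1..m} \<Longrightarrow> i \<in> {1..t} \<Longrightarrow>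
        AE \<omega> in M. cprob M (history M G t) (\<lambda>\<omega>'. W (t + 1) r \<omega>' = i) \<omega> =
          (2 * real m * real t + 1 - real (deg G i t \<omega>)) /
          (real t * (2 * real m * real t + 1 - 2 * real m))"
    and W_cond_indep:
      "\<And>t A. 1 \<le> t \<Longrightarrow>
        AE \<omega> in M. cprob M (history M G t) (\<lambda>\<omega>'. \<forall>r\<in>{1..m}. W (t + 1) r \<omega>' \<in> A r) \<omega> =
          (\<Prod>r\<in>{1..m}. cprob M (history M G t) (\<lambda>\<omega>'. W (t + 1) r \<omega>' \<in> A r) \<omega>)"

end

theory Submission
  imports Defs
begin

text \<open>
  The bound follows from Markov's inequality. At time \<open>t \<ge> 2\<close> a given vertex is the endpoint of a
  given new edge with conditional probability at most
  \<open>(2mt + 1) / (t (2mt + 1 - 2m)) \<le> 2 / t\<close>, because degrees are nonnegative. Hence the expected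
  degree of \<open>v\<^sub>i\<close> grows by at most \<open>2m / t\<close> in the step from \<open>t\<close> to \<open>t + 1\<close>
  (\<open>expectation_deg_step\<close>), and summing the harmonic series gives
  \<open>E d(v\<^sub>i, t) \<le> 2mi + 4m ln t\<close> (\<open>expectation_deg_le\<close>). Since \<open>\<gamma> t \<longlongrightarrow> \<infinity>\<close>, the quotient of this
  bound by \<open>\<kappa> \<gamma> t ln t\<close> tends to \<open>0\<close>.
\<close>

lemma degree_le_twice_size: "degree H v \<le> 2 * size (edges H)"
proof -
  have "size {#e \<in># edges H. v \<in> set_uprod e#} \<le> size (edges H)"
    by (rule size_filter_mset_lesseq)
  moreover have "count (edges H) (Upair v v) \<le> size (edges H)"
    by (rule count_le_size)
  ultimately show ?thesis
    unfolding degree_def by linarith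
qed

lemma ln_increment_ge:
  assumes "1 \<le> t"
  shows "1 / real t \<le> 2 * (ln (real (t + 1)) - ln (real t))"
proof -
  have "1 / real t \<le> 2 * (1 / real (t + 1))"
    using assms by (simp add: field_simps)
  also have "1 / real (t + 1) = 1 - real t / real (t + 1)"
    by (simp add: field_simps)
  also have "\<dots> \<le> - ln (real t / real (t + 1))"
    using ln_le_minus_one[of "real t / real (t + 1)"] assms by simp
  also have "\<dots> = ln (real (t + 1)) - ln (real t)"
    using assms by (simp add: ln_divide_pos)
  finally show ?thesis
    by simp
qed

context pure_apa_process
begin

lemma size_edges:
  assumes "1 \<le> t" "\<omega> \<in> space M"
  shows "size (edges (G t \<omega>)) = m * t"
  using assms(1)
proof (induction t rule: dec_induct)
  case base
  then show ?case
    using G_initial[OF assms(2)] by simp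
next
  case (step t)
  then show ?case
    using G_step[OF _ assms(2), of t] by simp
qed

lemma deg_le:
  assumes "1 \<le> t" "\<omega> \<in> space M"
  shows "deg G i t \<omega> \<le> 2 * m * t"
  using degree_le_twice_size[of "G t \<omega>" i] size_edges[OF assms] by (simp add: deg_def)

lemma integrable_deg:
  assumes "1 \<le> t"
  shows "integrable M (\<lambda>\<omega>. real (deg G i t \<omega>))"
proof (rule integrable_const_bound[where B = "real (2 * m * t)"])
  show "AE \<omega> in M. norm (real (deg G i t \<omega>)) \<le> real (2 * m * t)"
    using deg_le[OF assms] by (intro AE_I2) (simp only: real_norm_def abs_of_nat of_nat_le_iff)
  show "(\<lambda>\<omega>. real (deg G i t \<omega>)) \<in> borel_measurable M"
    unfolding deg_def
    by (rule measurable_compose[OF measurable_G[OF assms]]) simp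
qed

lemma deg_step:
  assumes "1 \<le> t" "i \<le> t" "\<omega> \<in> space M"
  shows "real (deg G i (t + 1) \<omega>) =
    real (deg G i t \<omega>) + (\<Sum>r\<in>{1..m}. indicator {\<omega> \<in> space M. W (t + 1) r \<omega> = i} \<omega>)"
proof -
  let ?N = "{#Upair (t + 1) (W (t + 1) r \<omega>). r \<in># mset_set {1..m}#}"
  \<comment> \<open>A new edge contains the new vertex \<open>t + 1 \<noteq> i\<close>, so it is no loop at \<open>i\<close>.\<close>
  have "Upair i i \<notin># ?N"
    using assms by auto
  hence loops: "count ?N (Upair i i) = 0"
    by (rule not_in_iff[THEN iffD1])
  have "size {#e \<in># ?N. i \<in> set_uprod e#} = card {r \<in> {1..m}. W (t + 1) r \<omega> = i}"
    using assms by (simp add: filter_mset_image_mset eq_commute[of i])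
  also have "real \<dots> = (\<Sum>r\<in>{1..m}. indicator {\<omega> \<in> space M. W (t + 1) r \<omega> = i} \<omega>)"
    using assms by (simp add: indicator_def sum.If_cases Int_def)
  finally show ?thesis
    using assms loops G_step[of t \<omega>] by (simp add: deg_def degree_def)
qed

lemma sigma_finite_subalgebra_history: "sigma_finite_subalgebra M (history M G t)"
proof -
  have "subalgebra M (history M G t)"
    unfolding subalgebra_def history_def
    using measurable_G
    by (subst sets_measure_of) (auto intro!: sets.sigma_sets_subset measurable_sets
        simp del: sets_measure_of simp: space_measure_of_conv)
  then show ?thesis
    by (intro finite_measure_subalgebra_is_sigma_finite) (simp add: finite_measure_subalgebra_def
        finite_measure_subalgebra_axioms_def finite_measure_axioms)
qed

lemma sets_attach:
  assumes "1 \<le> t" "r \<in> {1..m}"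
  shows "{\<omega> \<in> space M. W (t + 1) r \<omega> = i} \<in> sets M"
proof -
  have "{\<omega> \<in> space M. W (t + 1) r \<omega> = i} = W (t + 1) r -` {i} \<inter> space M"
    by auto
  with measurable_W[OF assms] show ?thesis
    by (simp add: measurable_sets)
qed

lemma prob_attach_le:
  assumes "2 \<le> t" "r \<in> {1..m}" "i \<in> {1..t}"
  shows "\<P>(\<omega> in M. W (t + 1) r \<omega> = i) \<le> 2 / real t"
proof -
  interpret H: sigma_finite_subalgebra M "history M G t"
    by (rule sigma_finite_subalgebra_history)
  let ?A = "{\<omega> \<in> space M. W (t + 1) r \<omega> = i}"
  let ?c = "cprob M (history M G t) (\<lambda>\<omega>. W (t + 1) r \<omega> = i)"
  have A: "?A \<in> sets M"
    using assms by (intro sets_attach) simp_all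
  have int: "integrable M (indicator ?A :: 'a \<Rightarrow> real)"
    using A by (simp add: integrable_indicator_iff less_top[symmetric])
  have ratio: "(2 * real m * real t + 1 - real d) / (real t * (2 * real m * real t + 1 - 2 * real m))
      \<le> 2 / real t" for d :: nat
  proof -
    have "real m * 2 \<le> real m * real t"
      using assms(1) by (intro mult_left_mono) simp_all
    \<comment> \<open>The factor 2 fails at \<open>t = 1\<close>, where the denominator is 1.\<close>
    hence *: "2 * real m * real t + 1 \<le> 2 * (2 * real m * real t + 1 - 2 * real m)"
      and pos: "0 < 2 * real m * real t + 1 - 2 * real m"
      by (simp_all add: algebra_simps)
    have "(2 * real m * real t + 1 - real d) / (2 * real m * real t + 1 - 2 * real m) \<le> 2"
      using * pos by (simp add: pos_divide_le_eq)
    from divide_right_mono[OF this, of "real t"] show ?thesis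
      by (simp add: mult.commute)
  qed
  have "AE \<omega> in M. ?c \<omega> \<le> 2 / real t"
    using W_law[of t r i] assms ratio by (auto elim!: eventually_mono)
  moreover have "integrable M ?c"
    unfolding cprob_def using H.real_cond_exp_int(1)[OF int] .
  ultimately have "expectation ?c \<le> 2 / real t"
    by (rule integral_le_const[rotated])
  moreover have "expectation ?c = prob ?A"
    unfolding cprob_def using H.real_cond_exp_int(2)[OF int] A by simp
  ultimately show ?thesis
    by simp
qed

lemma expectation_deg_step:
  assumes "2 \<le> t" "i \<in> {1..t}"
  shows "expectation (\<lambda>\<omega>. real (deg G i (t + 1) \<omega>)) \<le>
    expectation (\<lambda>\<omega>. real (deg G i t \<omega>)) + 2 * real m / real t"
proof -
  let ?A = "\<lambda>r. {\<omega> \<in> space M. W (t + 1) r \<omega> = i}"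
  have A: "?A r \<in> sets M" if "r \<in> {1..m}" for r
    using assms that by (intro sets_attach) simp_all
  have int: "integrable M (indicator (?A r) :: 'a \<Rightarrow> real)" if "r \<in> {1..m}" for r
    using A[OF that] by (simp add: integrable_indicator_iff less_top[symmetric])
  have "expectation (\<lambda>\<omega>. real (deg G i (t + 1) \<omega>)) =
      expectation (\<lambda>\<omega>. real (deg G i t \<omega>) + (\<Sum>r\<in>{1..m}. indicator (?A r) \<omega>))"
    using assms by (intro Bochner_Integration.integral_cong refl deg_step) simp_all
  also have "\<dots> = expectation (\<lambda>\<omega>. real (deg G i t \<omega>)) + (\<Sum>r\<in>{1..m}. prob (?A r))"
    using assms int A integrable_deg[of t i]
    by (subst Bochner_Integration.integral_add)
      (auto simp: Bochner_Integration.integral_sum)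
  also have "(\<Sum>r\<in>{1..m}. prob (?A r)) \<le> (\<Sum>r\<in>{1..m}. 2 / real t)"
    using assms by (intro sum_mono prob_attach_le) simp_all
  finally show ?thesis
    by (simp add: mult.commute)
qed

lemma expectation_deg_le:
  assumes "2 \<le> i" "i \<le> t"
  shows "expectation (\<lambda>\<omega>. real (deg G i t \<omega>)) \<le> 2 * real m * real i + 4 * real m * ln (real t)"
  using assms(2)
proof (induction t rule: dec_induct)
  case base
  \<comment> \<open>The degree at time \<open>i\<close> equals \<open>m\<close>, but any bound independent of \<open>t\<close> is good enough.\<close>
  have "real (deg G i i \<omega>) \<le> real (2 * m * i)" if "\<omega> \<in> space M" for \<omega>
    using assms(1) that by (intro of_nat_mono deg_le) simp_all
  hence "expectation (\<lambda>\<omega>. real (deg G i i \<omega>)) \<le> real (2 * m * i)"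
    using assms(1) by (intro integral_le_const integrable_deg AE_I2) simp_all
  moreover have "0 \<le> 4 * real m * ln (real i)"
    using assms(1) by simp
  ultimately show ?case
    by simp
next
  case (step t)
  have "2 * real m / real t \<le> 4 * real m * (ln (real (t + 1)) - ln (real t))"
    using mult_left_mono[OF ln_increment_ge[of t], of "2 * real m"] step.hyps assms(1)
    by (simp add: algebra_simps)
  with expectation_deg_step[of t i] step assms(1) show ?case
    by (simp add: algebra_simps)
qed

end

theorem theorem3p7:
  fixes M :: "'a measure" and m i :: nat
    and G :: "nat \<Rightarrow> 'a \<Rightarrow> nat multigraph" and W :: "nat \<Rightarrow> nat \<Rightarrow> 'a \<Rightarrow> nat"
    and \<gamma> :: "nat \<Rightarrow> real" and \<kappa> :: real
  assumes "pure_apa_process M m G W"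
    and "1 < i"
    and "\<And>t. 1 \<le> t \<Longrightarrow> 0 < \<gamma> t"
    and "filterlim \<gamma> at_top sequentially"
    and "(\<lambda>t. 1 / \<gamma> t * (\<Sum>j=2..t. 1 / (real j * ln (real j)))) \<longlonglongrightarrow> 0"
    and "1 < \<kappa>"
  shows "(\<lambda>t. \<P>(\<omega> in M. real (deg G i t \<omega>) \<le> \<kappa> * \<gamma> t * ln (real t))) \<longlonglongrightarrow> 1"
proof -
  interpret pure_apa_process M m G W
    by fact
  let ?b = "\<lambda>t. (2 * real m * real i / ln (real t) + 4 * real m) / (\<kappa> * \<gamma> t)"
  have tail: "1 - ?b t \<le> \<P>(\<omega> in M. real (deg G i t \<omega>) \<le> \<kappa> * \<gamma> t * ln (real t))" if "i \<le> t" for t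
  proof -
    let ?c = "\<kappa> * \<gamma> t * ln (real t)"
    have t: "2 \<le> t" "1 \<le> t"
      using that assms(2) by auto
    have lnt: "0 < ln (real t)"
      using t by simp
    have pos: "0 < \<kappa> * \<gamma> t"
      using assms(3)[OF t(2)] assms(6) by simp
    hence c: "0 < ?c"
      using lnt by simp
    note [measurable] = borel_measurable_integrable[OF integrable_deg[OF t(2), of i]]
    have "prob {\<omega> \<in> space M. ?c \<le> real (deg G i t \<omega>)} \<le> expectation (\<lambda>\<omega>. real (deg G i t \<omega>)) / ?c"
      using integrable_deg[OF t(2)] c by (intro integral_Markov_inequality_measure[where A = "{}"]) auto
    also have "\<dots> \<le> (2 * real m * real i + 4 * real m * ln (real t)) / ?c"
      using expectation_deg_le[of i t] assms(2) that c by (intro divide_right_mono) auto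
    also have "\<dots> = ?b t"
      using lnt pos by (simp add: field_simps)
    finally have "prob {\<omega> \<in> space M. ?c \<le> real (deg G i t \<omega>)} \<le> ?b t" .
    moreover have "prob {\<omega> \<in> space M. \<not> real (deg G i t \<omega>) \<le> ?c}
        \<le> prob {\<omega> \<in> space M. ?c \<le> real (deg G i t \<omega>)}"
      by (intro finite_measure_mono) auto
    moreover have "prob {\<omega> \<in> space M. \<not> real (deg G i t \<omega>) \<le> ?c}
        = 1 - prob {\<omega> \<in> space M. real (deg G i t \<omega>) \<le> ?c}"
      by (rule prob_neg) measurable
    ultimately show ?thesis
      by linarith
  qed
  have "filterlim (\<lambda>t. \<kappa> * \<gamma> t) at_top sequentially"
    using assms(4,6) by (intro filterlim_tendsto_pos_mult_at_top[OF tendsto_const]) auto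
  moreover have "((\<lambda>t. 2 * real m * real i / ln (real t) + 4 * real m) \<longlongrightarrow> 0 + 4 * real m) sequentially"
    by (intro tendsto_intros real_tendsto_divide_at_top[OF tendsto_const]
        filterlim_compose[OF ln_at_top filterlim_real_sequentially])
  ultimately have "?b \<longlonglongrightarrow> 0"
    by (rule real_tendsto_divide_at_top[rotated])
  hence lim: "(\<lambda>t. 1 - ?b t) \<longlonglongrightarrow> 1"
    by (auto intro: tendsto_eq_intros)
  show ?thesis
  proof (rule tendsto_sandwich[OF _ _ lim tendsto_const])
    show "\<forall>\<^sub>F t in sequentially. 1 - ?b t \<le> \<P>(\<omega> in M. real (deg G i t \<omega>) \<le> \<kappa> * \<gamma> t * ln (real t))"
      using eventually_ge_at_top[of i] by eventually_elim (rule tail)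
  qed simp
qed

end
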